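(* Let $n,m$ be positive integers and $I\ge0$ an integer, and let $\Pi$, $a_i$, $\theta_i$, $\mathcal{O}_i$ ($i\in\mathbb{I}=\{0,\dots,I\}$), $\mathcal{M}$, $x(0)$, $x_d$ be as in the context and satisfy assumptions (A1)–(A4) stated there. Let $\psi:\mathbb{S}^n\setminus\{e_{n+1}\}\to\mathbb{R}^n$ be the stereographic projection. Then the images under $\psi$ of the constraint zones are the following pairwise disjoint subsets of $\mathbb{R}^n$: $$\tilde{\mathcal{O}}_0:=\psi(\mathcal{O}_0\setminus\{e_{n+1}\})=\{\xi\in\mathbb{R}^n:\|\xi\|>\cot(\theta_0/2)\},$$ $$\tilde{\mathcal{O}}_i:=\psi(\mathcal{O}_i)=\{\xi\in\mathbb{R}^n:\|\xi-c_i\|<r_i\},\qquad i\in\mathbb{I}\setminus\{0\},$$ where $c_i\in\mathbb{R}^n$ and $r_i\in\mathbb{R}_{>0}$ are given by $$c_i=\frac{J_na_i}{\cos(\theta_i)-a_0^\top a_i},\qquad r_i=\frac{\sin(\theta_i)}{\cos(\theta_i)-a_0^\top a_i}.$$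
   Context: $\mathbb{S}^n=\{x\in\mathbb{R}^{n+1}:\|x\|=1\}$ with tangent space $\mathsf{T}_x\mathbb{S}^n=\{z\in\mathbb{R}^{n+1}:z^\top x=0\}$; $e_{n+1}$ is the last standard basis vector of $\mathbb{R}^{n+1}$ and $J_n=[\,I_n\;\;0_{n\times1}]\in\mathbb{R}^{n\times(n+1)}$. The underlying system is $\dot x=\Pi(x)u$ on $\mathbb{S}^n$, $u\in\mathbb{R}^m$, where $\Pi:\mathbb{R}^{n+1}\to\mathbb{R}^{(n+1)\times m}$ is smooth with $\mathrm{Im}(\Pi(x))\subseteq\mathsf{T}_x\mathbb{S}^n$ for $x\in\mathbb{S}^n$. Constraint zones: $\mathcal{O}_i=\{x\in\mathbb{S}^n:x^\top a_i>\cos\theta_i\}$ with $a_i\in\mathbb{S}^n$, $\theta_i\in(0,\pi/2)$, $i\in\mathbb{I}=\{0,\dots,I\}$; $\mathcal{M}=\mathbb{S}^n\setminus\bigcup_{i\in\mathbb{I}}\mathcal{O}_i$. Assumptions: (A1) $\mathrm{rank}(\Pi(x))=n$ for all $x\in\mathbb{S}^n\setminus\{e_{n+1}\}$. (A2) $a_i^\top a_{i'}<\cos(\theta_i+\theta_{i'})$ for all $i\ne i'$ in $\mathbb{I}$. (A3) $a_0=e_{n+1}$. (A4) $x(0)\in\mathcal{M}$ and $x_d\in\mathbf{int}(\mathcal{M})$ (interior in $\mathbb{S}^n$). Stereographic projection: $\psi(x)=\dfrac{J_nx}{1-e_{n+1}^\top x}$ for $x\in\mathbb{S}^n\setminus\{e_{n+1}\}$.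 *)

theory Defs
  imports "HOL-Analysis.Analysis"
begin

(* R^(n+1) is the type real^('n option) with n = CARD('n): the coordinates Some j are the
   first n ones, and None is the last one. *)

definition e_last :: "real ^ ('n::finite option)" where
  "e_last = axis None 1"

definition J :: "real ^ ('n::finite option) ^ 'n" where
  "J = (\<chi> i j. if j = Some i then 1 else 0)"

definition tangent_space :: "real ^ ('n::finite option) \<Rightarrow> (real ^ ('n option)) set" where
  "tangent_space x = {z. z \<bullet> x = 0}"

(* C^k on the whole space, through iterated directional derivatives. *)
primrec Ck :: "nat \<Rightarrow> ('a::euclidean_space \<Rightarrow> 'b::real_normed_vector) \<Rightarrow> bool" where
  "Ck 0 f \<longleftrightarrow> continuous_on UNIV f"
| "Ck (Suc k) f \<longleftrightarrow>
     (\<forall>x. f differentiable (at x)) \<and>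
     (\<forall>v. Ck k (\<lambda>x. frechet_derivative f (at x) v))"

definition smooth :: "('a::euclidean_space \<Rightarrow> 'b::real_normed_vector) \<Rightarrow> bool" where
  "smooth f \<longleftrightarrow> (\<forall>k. Ck k f)"

definition zone :: "real ^ ('n::finite option) \<Rightarrow> real \<Rightarrow> (real ^ ('n option)) set" where
  "zone a \<theta> = {x \<in> sphere 0 1. x \<bullet> a > cos \<theta>}"

definition free_space ::
  "nat \<Rightarrow> (nat \<Rightarrow> real ^ ('n::finite option)) \<Rightarrow> (nat \<Rightarrow> real) \<Rightarrow> (real ^ ('n option)) set" where
  "free_space I a \<theta> = sphere 0 1 - (\<Union>i\<in>{0..I}. zone (a i) (\<theta> i))"

(* Meaningful only on sphere 0 1 - {e_last}. *)
definition stereo :: "real ^ ('n::finite option) \<Rightarrow> real ^ 'n" where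
  "stereo x = (1 / (1 - e_last \<bullet> x)) *\<^sub>R (J *v x)"

definition proj_zone ::
  "(nat \<Rightarrow> real ^ ('n::finite option)) \<Rightarrow> (nat \<Rightarrow> real) \<Rightarrow> nat \<Rightarrow> (real ^ 'n) set" where
  "proj_zone a \<theta> i =
     (if i = 0 then stereo ` (zone (a 0) (\<theta> 0) - {e_last}) else stereo ` zone (a i) (\<theta> i))"

definition centre ::
  "(nat \<Rightarrow> real ^ ('n::finite option)) \<Rightarrow> (nat \<Rightarrow> real) \<Rightarrow> nat \<Rightarrow> real ^ 'n" where
  "centre a \<theta> i = (1 / (cos (\<theta> i) - a 0 \<bullet> a i)) *\<^sub>R (J *v a i)"

definition radius ::
  "(nat \<Rightarrow> real ^ ('n::finite option)) \<Rightarrow> (nat \<Rightarrow> real) \<Rightarrow> nat \<Rightarrow> real" where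
  "radius a \<theta> i = sin (\<theta> i) / (cos (\<theta> i) - a 0 \<bullet> a i)"

end

theory Submission
  imports Defs
begin

text \<open>With \<open>\<xi> = stereo x\<close> one has \<open>x = (2 \<xi>, norm \<xi> ^ 2 - 1) / (norm \<xi> ^ 2 + 1)\<close>, so the linear
  inequality \<open>x \<bullet> a > cos \<theta>\<close> becomes a quadratic one in \<open>\<xi>\<close> with leading coefficient
  \<open>cos \<theta> - e_last \<bullet> a\<close>, and completing the square gives the ball. Disjointness is the
  triangle inequality for the angular metric on the sphere.\<close>

section \<open>Splitting off the last coordinate\<close>

lemma J_mult_nth [simp]: "(J *v x) $ i = x $ Some i"
  by (simp add: J_def matrix_vector_mult_def mult_delta_left)

lemma e_last_inner [simp]: "e_last \<bullet> x = x $ None"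
  by (simp add: e_last_def inner_axis')

lemma J_mult_e_last [simp]: "J *v e_last = 0"
  by (simp add: vec_eq_iff e_last_def axis_def)

lemma inner_split_last:
  fixes x y :: "real ^ ('n::finite option)"
  shows "x \<bullet> y = (J *v x) \<bullet> (J *v y) + x $ None * y $ None"
  by (simp add: inner_vec_def UNIV_option_conv sum.reindex)

lemma sphere_split_last:
  fixes x :: "real ^ ('n::finite option)"
  assumes "x \<in> sphere 0 1"
  shows "(J *v x) \<bullet> (J *v x) = 1 - (x $ None)\<^sup>2"
  using assms inner_split_last[of x x] by (simp add: norm_eq_1 power2_eq_square)

text \<open>If the last coordinate of a unit vector is 1, the others have norm zero, so the vector
  is the pole. Away from the pole, the denominator of \<open>stereo\<close> is therefore
  positive.\<close>

lemma sphere_last_less_1: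
  fixes x :: "real ^ ('n::finite option)"
  assumes "x \<in> sphere 0 1" "x \<noteq> e_last"
  shows "x $ None < 1"
proof -
  have "x $ None \<le> 1"
    using assms(1) component_le_norm_cart[of x None] by simp
  moreover have "x = e_last" if "x $ None = 1"
  proof -
    have "J *v x = 0"
      using sphere_split_last[OF assms(1)] that by simp
    then have "x $ Some i = 0" for i
      by (metis J_mult_nth zero_index)
    then have "x $ k = e_last $ k" for k
      using that by (cases k) (simp_all add: e_last_def axis_def)
    then show ?thesis
      by (simp add: vec_eq_iff)
  qed
  ultimately show ?thesis
    using assms(2) by fastforce
qed

section \<open>The inverse of the stereographic projection\<close>

text \<open>The line from the pole through the point (\<xi>, 0) of the equatorial hyperplane meets
  the sphere a second time here.\<close>

definition stereo_inv :: "real ^ 'n::finite \<Rightarrow> real ^ ('n option)" where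
  "stereo_inv \<xi> = (\<chi> k. case k of None \<Rightarrow> (\<xi> \<bullet> \<xi> - 1) / (\<xi> \<bullet> \<xi> + 1)
                       | Some i \<Rightarrow> 2 * \<xi> $ i / (\<xi> \<bullet> \<xi> + 1))"

lemma stereo_inv_last: "stereo_inv \<xi> $ None = (\<xi> \<bullet> \<xi> - 1) / (\<xi> \<bullet> \<xi> + 1)"
  by (simp add: stereo_inv_def)

lemma J_mult_stereo_inv: "J *v stereo_inv \<xi> = (2 / (\<xi> \<bullet> \<xi> + 1)) *\<^sub>R \<xi>"
  by (simp add: vec_eq_iff stereo_inv_def)

lemma stereo_inv_stereo:
  assumes "x \<in> sphere 0 1 - {e_last}"
  shows "stereo_inv (stereo x) = x"
proof -
  define t where "t = x $ None"
  have t: "t < 1"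
    using assms sphere_last_less_1 by (auto simp: t_def)
  have "stereo x \<bullet> stereo x = (1 - t\<^sup>2) / (1 - t)\<^sup>2"
    using assms sphere_split_last[of x]
    by (simp add: stereo_def t_def power2_eq_square)
  also have "\<dots> = (1 + t) / (1 - t)"
    using t by (simp add: divide_simps) algebra
  finally have sq: "stereo x \<bullet> stereo x = (1 + t) / (1 - t)" .
  \<comment> \<open>These are the denominator and the numerator in \<open>stereo_inv\<close>, so the
    factors \<open>1 - t\<close> cancel coordinate by coordinate.\<close>
  have sq1: "stereo x \<bullet> stereo x + 1 = 2 / (1 - t)" "stereo x \<bullet> stereo x - 1 = 2 * t / (1 - t)"
    using t unfolding sq by (simp_all add: field_simps)
  have "stereo_inv (stereo x) $ k = x $ k" for k
    using t by (cases k) (simp_all add: stereo_inv_def sq1, simp_all add: stereo_def t_def)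
  then show ?thesis
    by (simp add: vec_eq_iff)
qed

lemma stereo_inv_in_sphere: "stereo_inv \<xi> \<in> sphere 0 1 - {e_last}"
proof -
  have pos: "\<xi> \<bullet> \<xi> + 1 > 0"
    by (simp add: add_nonneg_pos)
  have "stereo_inv \<xi> \<bullet> stereo_inv \<xi> = 1"
    unfolding inner_split_last J_mult_stereo_inv stereo_inv_last
    using pos by (simp add: divide_simps) algebra
  moreover have "stereo_inv \<xi> $ None < 1"
    using pos by (simp add: stereo_inv_last)
  then have "stereo_inv \<xi> \<noteq> e_last"
    by (auto simp: e_last_def)
  ultimately show ?thesis
    by (simp add: norm_eq_1)
qed

lemma stereo_stereo_inv: "stereo (stereo_inv \<xi>) = \<xi>"
proof -
  have pos: "\<xi> \<bullet> \<xi> + 1 > 0"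
    by (simp add: add_nonneg_pos)
  have "1 - stereo_inv \<xi> $ None = 2 / (\<xi> \<bullet> \<xi> + 1)"
    using pos by (simp add: stereo_inv_last field_simps)
  then have "1 / (1 - stereo_inv \<xi> $ None) * (2 / (\<xi> \<bullet> \<xi> + 1)) = 1"
    using pos by simp
  then show ?thesis
    unfolding stereo_def J_mult_stereo_inv e_last_inner scaleR_scaleR by simp
qed

lemma inj_on_stereo: "inj_on stereo (sphere 0 1 - {e_last})"
  by (rule inj_on_inverseI[where g = stereo_inv]) (rule stereo_inv_stereo)

section \<open>Images of spherical caps\<close>

text \<open>Multiply by the positive denominator \<open>\<xi> \<bullet> \<xi> + 1\<close> and
  collect powers of \<xi>. The sign of the leading coefficient stays open: it is negative for the
  zone around the pole and positive for the others.\<close>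

lemma stereo_inv_inner_gt_iff:
  "stereo_inv \<xi> \<bullet> a > c
    \<longleftrightarrow> (c - a $ None) * (\<xi> \<bullet> \<xi>) - 2 * (\<xi> \<bullet> (J *v a)) + (c + a $ None) < 0"
proof -
  have pos: "\<xi> \<bullet> \<xi> + 1 > 0"
    by (simp add: add_nonneg_pos)
  have "stereo_inv \<xi> \<bullet> a
      = (2 * (\<xi> \<bullet> (J *v a)) + (\<xi> \<bullet> \<xi> - 1) * a $ None) / (\<xi> \<bullet> \<xi> + 1)"
    unfolding inner_split_last J_mult_stereo_inv stereo_inv_last
    by (simp add: add_divide_distrib)
  then show ?thesis
    using pos by (simp add: pos_less_divide_eq algebra_simps)
qed

lemma stereo_image_zone:
  "stereo ` (zone a \<theta> - {e_last})
    = {\<xi>. (cos \<theta> - a $ None) * (\<xi> \<bullet> \<xi>) - 2 * (\<xi> \<bullet> (J *v a)) + (cos \<theta> + a $ None) < 0}"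
proof -
  have "stereo ` (zone a \<theta> - {e_last}) = {\<xi>. stereo_inv \<xi> \<bullet> a > cos \<theta>}"
  proof (intro set_eqI iffI)
    fix \<xi> assume "\<xi> \<in> stereo ` (zone a \<theta> - {e_last})"
    then obtain x where x: "x \<in> zone a \<theta> - {e_last}" "\<xi> = stereo x"
      by blast
    then have "stereo_inv \<xi> = x"
      by (simp add: zone_def stereo_inv_stereo)
    then show "\<xi> \<in> {\<xi>. stereo_inv \<xi> \<bullet> a > cos \<theta>}"
      using x by (simp add: zone_def)
  next
    fix \<xi> assume "\<xi> \<in> {\<xi>. stereo_inv \<xi> \<bullet> a > cos \<theta>}"
    then have "stereo_inv \<xi> \<in> zone a \<theta> - {e_last}"
      using stereo_inv_in_sphere[of \<xi>] by (auto simp: zone_def)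
    then show "\<xi> \<in> stereo ` (zone a \<theta> - {e_last})"
      using stereo_stereo_inv by (metis imageI)
  qed
  then show ?thesis
    by (simp add: stereo_inv_inner_gt_iff)
qed

text \<open>For a cap centred at the pole the linear term vanishes and the leading coefficient is
  negative, so the image is the exterior of a ball around the origin.\<close>

lemma stereo_image_zone_e_last:
  fixes \<theta> :: real
  assumes "0 < \<theta>" "\<theta> < pi"
  shows "stereo ` (zone e_last \<theta> - {e_last})
    = {\<xi> :: real ^ 'n::finite. norm \<xi> > cot (\<theta> / 2)}"
proof -
  define s c where "s = sin (\<theta> / 2)" and "c = cos (\<theta> / 2)"
  have s: "s > 0" and c: "c > 0"
    using assms by (auto simp: s_def c_def intro: sin_gt_zero cos_gt_zero)
  have cos: "cos \<theta> = 2 * c\<^sup>2 - 1" and sc: "s\<^sup>2 + c\<^sup>2 = 1"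
    using cos_double_cos[of "\<theta> / 2"] by (simp_all add: s_def c_def)
  have "(cos \<theta> - 1) * (\<xi> \<bullet> \<xi>) + (cos \<theta> + 1) < 0 \<longleftrightarrow> norm \<xi> > cot (\<theta> / 2)" for \<xi> :: "real ^ 'n"
  proof -
    \<comment> \<open>Half-angle formulas: \<open>cos \<theta> - 1\<close> is -2 times the square of
      \<open>s\<close>, and \<open>cos \<theta> + 1\<close> is twice the square of
      \<open>c\<close>.\<close>
    have "(cos \<theta> - 1) * (\<xi> \<bullet> \<xi>) + (cos \<theta> + 1) = 2 * (c\<^sup>2 - (s * norm \<xi>)\<^sup>2)"
      using sc unfolding cos power_mult_distrib power2_norm_eq_inner by algebra
    then have "(cos \<theta> - 1) * (\<xi> \<bullet> \<xi>) + (cos \<theta> + 1) < 0 \<longleftrightarrow> c\<^sup>2 < (s * norm \<xi>)\<^sup>2"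
      by (simp only: mult_less_0_iff diff_less_0_iff_less) simp
    also have "\<dots> \<longleftrightarrow> c < s * norm \<xi>"
      using s c by (auto intro!: power_strict_mono dest: power_less_imp_less_base)
    also have "\<dots> \<longleftrightarrow> norm \<xi> > cot (\<theta> / 2)"
      using s by (simp add: cot_def flip: s_def c_def) (simp add: divide_less_eq mult.commute)
    finally show ?thesis .
  qed
  moreover have "(e_last :: real ^ ('n option)) $ None = 1"
    by (simp add: e_last_def)
  ultimately show ?thesis
    unfolding stereo_image_zone by simp
qed

lemma e_last_notin_zone:
  assumes "a $ None < cos \<theta>"
  shows "e_last \<notin> zone a \<theta>"
  using assms by (simp add: zone_def)

text \<open>The assumption \<open>a $ None < cos \<theta>\<close> puts the pole outside the closed
  cap. This makes the leading coefficient positive, so the quadratic inequality describes a bounded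
  ball.\<close>

lemma stereo_image_zone_ball:
  fixes a :: "real ^ ('n::finite option)"
  assumes a: "a \<in> sphere 0 1" and d: "a $ None < cos \<theta>" and sin: "sin \<theta> > 0"
  shows "stereo ` zone a \<theta> =
    {\<xi>. norm (\<xi> - (1 / (cos \<theta> - a $ None)) *\<^sub>R (J *v a)) < sin \<theta> / (cos \<theta> - a $ None)}"
proof -
  define d where "d = cos \<theta> - a $ None"
  have d0: "d > 0" using d by (simp add: d_def)
  have "d * (\<xi> \<bullet> \<xi>) - 2 * (\<xi> \<bullet> (J *v a)) + (cos \<theta> + a $ None) < 0
      \<longleftrightarrow> norm (\<xi> - (1 / d) *\<^sub>R (J *v a)) < sin \<theta> / d" for \<xi>
  proof -
    \<comment> \<open>Completing the square after multiplying by \<open>d\<close>: \<open>q\<close>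
      is \<open>d\<close> times the difference of \<xi> and the centre.\<close>
    define q where "q = d *\<^sub>R \<xi> - J *v a"
    have "q \<bullet> q = d\<^sup>2 * (\<xi> \<bullet> \<xi>) - 2 * d * (\<xi> \<bullet> (J *v a)) + (J *v a) \<bullet> (J *v a)"
      by (simp add: q_def inner_diff_left inner_diff_right inner_commute[of "J *v a" \<xi>]
          power2_eq_square algebra_simps)
    \<comment> \<open>As \<open>a\<close> is a unit vector, the squared norm of
      \<open>J *v a\<close> minus the squared sine equals
      \<open>(cos \<theta> - a $ None) * (cos \<theta> + a $ None)\<close>, which is
      \<open>d\<close> times the constant term.\<close>
    then have "norm q ^ 2 - (sin \<theta>)\<^sup>2
        = d * (d * (\<xi> \<bullet> \<xi>) - 2 * (\<xi> \<bullet> (J *v a)) + (cos \<theta> + a $ None))"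
      using sphere_split_last[OF a] sin_cos_squared_add[of \<theta>]
      unfolding power2_norm_eq_inner d_def by algebra
    then have "d * (\<xi> \<bullet> \<xi>) - 2 * (\<xi> \<bullet> (J *v a)) + (cos \<theta> + a $ None) < 0
        \<longleftrightarrow> norm q ^ 2 < (sin \<theta>)\<^sup>2"
      using d0 by (metis diff_less_0_iff_less mult_less_0_iff order_less_asym)
    also have "\<dots> \<longleftrightarrow> norm q < sin \<theta>"
      using sin by (auto intro!: power_strict_mono dest: power_less_imp_less_base)
    also have "norm q = d * norm (\<xi> - (1 / d) *\<^sub>R (J *v a))"
    proof -
      have "q = d *\<^sub>R (\<xi> - (1 / d) *\<^sub>R (J *v a))"
        using d0 by (simp add: q_def scaleR_diff_right)
      then show ?thesis
        using d0 by simp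
    qed
    also have "\<dots> < sin \<theta> \<longleftrightarrow> norm (\<xi> - (1 / d) *\<^sub>R (J *v a)) < sin \<theta> / d"
      using d0 by (simp add: pos_less_divide_eq mult.commute)
    finally show ?thesis .
  qed
  moreover have "zone a \<theta> - {e_last} = zone a \<theta>"
    using e_last_notin_zone[OF d] by blast
  ultimately show ?thesis
    using stereo_image_zone[of a \<theta>] by (simp add: d_def)
qed

section \<open>Disjointness of caps\<close>

text \<open>The triangle inequality for angles, in cosine form: apply Cauchy-Schwarz to the
  components of \<open>a\<close> and \<open>b\<close> orthogonal to \<open>x\<close>, whose norms
  are the sines of the angles to \<open>x\<close>, and use the addition formula.\<close>

lemma unit_inner_ge:
  fixes x a b :: "'a::real_inner"
  assumes "norm x = 1" "norm a = 1" "norm b = 1"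
  shows "a \<bullet> b \<ge> cos (arccos (x \<bullet> a) + arccos (x \<bullet> b))"
proof -
  define u v where "u = x \<bullet> a" and "v = x \<bullet> b"
  have uv: "\<bar>u\<bar> \<le> 1" "\<bar>v\<bar> \<le> 1"
    using Cauchy_Schwarz_ineq2[of x a] Cauchy_Schwarz_ineq2[of x b] assms
    by (simp_all add: u_def v_def)
  have xx: "x \<bullet> x = 1" "a \<bullet> a = 1" "b \<bullet> b = 1"
    using assms by (simp_all add: norm_eq_1)
  have n: "norm (a - u *\<^sub>R x) = sqrt (1 - u\<^sup>2)" "norm (b - v *\<^sub>R x) = sqrt (1 - v\<^sup>2)"
    by (simp_all add: norm_eq_sqrt_inner inner_diff_left inner_diff_right xx u_def v_def
        inner_commute[of a x] inner_commute[of b x] power2_eq_square)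
  have "(a - u *\<^sub>R x) \<bullet> (b - v *\<^sub>R x) = a \<bullet> b - u * v"
    by (simp add: inner_diff_left inner_diff_right xx u_def v_def
        inner_commute[of a x] inner_commute[of b x])
  then have "a \<bullet> b - u * v \<ge> - (sqrt (1 - u\<^sup>2) * sqrt (1 - v\<^sup>2))"
    using Cauchy_Schwarz_ineq2[of "a - u *\<^sub>R x" "b - v *\<^sub>R x"] n by simp
  then show ?thesis
    using uv by (simp add: cos_add cos_arccos_abs sin_arccos_abs flip: u_def v_def)
qed

text \<open>A common point would be at angles less than \<alpha> and \<beta> from the two centres.
  Since \<open>\<alpha> + \<beta> \<le> pi\<close>, cosine is decreasing on the relevant range, and
  \<open>a \<bullet> b\<close> would exceed \<open>cos (\<alpha> + \<beta>)\<close>.\<close>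

lemma zone_disjoint:
  assumes a: "a \<in> sphere 0 1" "b \<in> sphere 0 1"
    and ang: "0 \<le> \<alpha>" "0 \<le> \<beta>" "\<alpha> + \<beta> \<le> pi"
    and ab: "a \<bullet> b \<le> cos (\<alpha> + \<beta>)"
  shows "zone a \<alpha> \<inter> zone b \<beta> = {}"
proof (rule ccontr)
  assume "zone a \<alpha> \<inter> zone b \<beta> \<noteq> {}"
  then obtain x where x: "norm x = 1" "x \<bullet> a > cos \<alpha>" "x \<bullet> b > cos \<beta>"
    by (auto simp: zone_def)
  have uv: "\<bar>x \<bullet> a\<bar> \<le> 1" "\<bar>x \<bullet> b\<bar> \<le> 1"
    using Cauchy_Schwarz_ineq2[of x a] Cauchy_Schwarz_ineq2[of x b] a x(1) by simp_all
  have "arccos (x \<bullet> a) < arccos (cos \<alpha>)" "arccos (x \<bullet> b) < arccos (cos \<beta>)"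
    using x uv by (intro arccos_less_arccos; simp)+
  then have "arccos (x \<bullet> a) + arccos (x \<bullet> b) < \<alpha> + \<beta>"
    using ang by (simp add: arccos_cos)
  moreover have "0 \<le> arccos (x \<bullet> a) + arccos (x \<bullet> b)"
    using uv by (simp add: arccos_lbound abs_le_iff)
  ultimately have "cos (arccos (x \<bullet> a) + arccos (x \<bullet> b)) > cos (\<alpha> + \<beta>)"
    using ang by (intro cos_monotone_0_pi) auto
  then show False
    using unit_inner_ge[of x a b] a x(1) ab by simp
qed

theorem lemma2:
  fixes P :: "real ^ ('n::finite option) \<Rightarrow> real ^ 'm::finite ^ ('n option)"
    and I :: nat
    and a :: "nat \<Rightarrow> real ^ ('n option)"
    and \<theta> :: "nat \<Rightarrow> real"
    and x0 xd :: "real ^ ('n option)"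
  assumes P_smooth: "smooth P"
    and P_tangent: "\<And>x. x \<in> sphere 0 1 \<Longrightarrow> range ((*v) (P x)) \<subseteq> tangent_space x"
    and a_sphere: "\<And>i. i \<in> {0..I} \<Longrightarrow> a i \<in> sphere 0 1"
    and theta_range: "\<And>i. i \<in> {0..I} \<Longrightarrow> \<theta> i \<in> {0<..<pi / 2}"
    and A1: "\<And>x. x \<in> sphere 0 1 - {e_last} \<Longrightarrow> rank (P x) = CARD('n)"
    and A2: "\<And>i j. i \<in> {0..I} \<Longrightarrow> j \<in> {0..I} \<Longrightarrow> i \<noteq> j \<Longrightarrow> a i \<bullet> a j < cos (\<theta> i + \<theta> j)"
    and A3: "a 0 = e_last"
    and A4: "x0 \<in> free_space I a \<theta>"
            "xd \<in> top_of_set (sphere 0 1) interior_of free_space I a \<theta>"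
  shows "disjoint_family_on (proj_zone a \<theta>) {0..I}
    \<and> proj_zone a \<theta> 0 = {\<xi>. norm \<xi> > cot (\<theta> 0 / 2)}
    \<and> (\<forall>i\<in>{0..I} - {0}.
          zone (a i) (\<theta> i) \<subseteq> sphere 0 1 - {e_last}
        \<and> radius a \<theta> i > 0
        \<and> proj_zone a \<theta> i = {\<xi>. norm (\<xi> - centre a \<theta> i) < radius a \<theta> i})"
proof -
  \<comment> \<open>The separation of zone \<open>i\<close> from zone 0, whose centre is the pole,
    makes the denominators of \<open>centre\<close> and \<open>radius\<close> positive. Both angles
    are below \<open>pi / 2\<close>, so their sum stays where cosine decreases.\<close>
  have last_less: "a i $ None < cos (\<theta> i)" if "i \<in> {0..I} - {0}" for i
  proof -
    have "a i $ None < cos (\<theta> 0 + \<theta> i)"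
      using A2[of 0 i] that A3 by simp
    also have "\<dots> < cos (\<theta> i)"
      using theta_range[of 0] theta_range[of i] that by (intro cos_monotone_0_pi) auto
    finally show ?thesis .
  qed
  have sin_pos: "sin (\<theta> i) > 0" if "i \<in> {0..I}" for i
    using theta_range[OF that] by (auto intro: sin_gt_zero)
  have avoid: "zone (a i) (\<theta> i) \<subseteq> sphere 0 1 - {e_last}" if "i \<in> {0..I} - {0}" for i
    using e_last_notin_zone[OF last_less[OF that]] by (auto simp: zone_def)
  \<comment> \<open>Removing the pole changes nothing for nonzero \<open>i\<close>, so all indices
    share one form, with the pole excluded.\<close>
  have proj_zone: "proj_zone a \<theta> i = stereo ` (zone (a i) (\<theta> i) - {e_last})"
    if "i \<in> {0..I}" for i
    using avoid[of i] that by (auto simp: proj_zone_def)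
  have "disjoint_family_on (proj_zone a \<theta>) {0..I}"
    unfolding disjoint_family_on_def
  proof (intro ballI impI)
    fix i j assume ij: "i \<in> {0..I}" "j \<in> {0..I}" "i \<noteq> j"
    have "zone (a i) (\<theta> i) \<inter> zone (a j) (\<theta> j) = {}"
      using theta_range[OF ij(1)] theta_range[OF ij(2)] A2[OF ij]
      by (intro zone_disjoint a_sphere ij) auto
    moreover have "zone (a k) (\<theta> k) - {e_last} \<subseteq> sphere 0 1 - {e_last}" for k
      by (auto simp: zone_def)
    ultimately show "proj_zone a \<theta> i \<inter> proj_zone a \<theta> j = {}"
      unfolding proj_zone[OF ij(1)] proj_zone[OF ij(2)]
      \<comment> \<open>By injectivity of \<open>stereo\<close> off the pole, the intersection of
        the images is the image of the intersection, which is empty.\<close>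
      by (subst inj_on_image_Int[OF inj_on_stereo, symmetric]) blast+
  qed
  moreover have "proj_zone a \<theta> 0 = {\<xi>. norm \<xi> > cot (\<theta> 0 / 2)}"
    using theta_range[of 0] A3 by (simp add: proj_zone_def stereo_image_zone_e_last)
  moreover have "radius a \<theta> i > 0" if "i \<in> {0..I} - {0}" for i
    using sin_pos[of i] last_less[OF that] that by (simp add: radius_def A3)
  moreover have "proj_zone a \<theta> i = {\<xi>. norm (\<xi> - centre a \<theta> i) < radius a \<theta> i}"
    if "i \<in> {0..I} - {0}" for i
    using stereo_image_zone_ball[OF a_sphere last_less[OF that] sin_pos] that
    by (simp add: proj_zone_def centre_def radius_def A3)
  ultimately show ?thesis
    using avoid by blast
qed

end
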